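(* Let $n\ge 1$ and let $\gamma_{n,i,j}$ (for integers $i,j\ge0$ with $j+2i\le n-1$) be integers such that $$A_n(s,t)=\sum_{i,j}\gamma_{n,i,j}(st)^i(s+t)^j(1+st)^{n-1-j-2i}.$$ Then $$B_n(s,t)=\sum_{i,j}\gamma_{n,i,j}(st+s+t+1)^i(s+t+2)^j(st+s+t+2)^{n-1-j-2i}$$ and $$B^{\circ}_n(s,t)=\sum_{i,j}\gamma_{n,i,j}(st+s+t+1)^i(s+t+2)^{n-1-j-2i}(st+s+t+2)^{j}.$$ Moreover, if $\gamma^{\circ}_{n,i,j}$ (same index range) are such that $A^{\circ}_n(s,t)=\sum_{i,j}\gamma^{\circ}_{n,i,j}(st)^i(s+t)^j(1+st)^{n-1-j-2i}$, then $\gamma^{\circ}_{n,i,j}=\gamma_{n,i,n-1-j-2i}$ for all $i,j$. All sums are over integers $i,j\ge 0$ with $j+2i\le n-1$.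
   Context: Let $[n]=\{1,\dots,n\}$. A Cayley permutation on $[n]$ is a map $v:[n]\to[n]$ with image $[k]$ for some $k\le n$. $\mathrm{Cay}[n]$ is the set of Cayley permutations on $[n]$, $\mathrm{Sym}[n]$ the set of permutations of $[n]$, and $\mathrm{I}[n]$ the set of weakly increasing Cayley permutations on $[n]$. $\max(v)$ denotes the largest letter of $v$. For a word $v$ of length $n$: $D(v)=\{i\in[n-1]: v(i)\ge v(i+1)\}$, $D^{\circ}(v)=\{i\in[n-1]: v(i)>v(i+1)\}$, $\mathrm{des}(v)=|D(v)|$, $\mathrm{asc}(v)=|\{i\in[n-1]: v(i)\le v(i+1)\}|$. $\mathrm{Bur}[n]=\{(u,v)\in\mathrm{I}[n]\times\mathrm{Cay}[n]: D(u)\subseteq D(v)\}$ and $\mathrm{Bur}^{01}[n]=\{(u,v)\in\mathrm{I}[n]\times\mathrm{Cay}[n]: D(u)\subseteq D^{\circ}(v)\}$. $A_n(s,t)=\sum_{v\in\mathrm{Sym}[n]}s^{\mathrm{des}(v)}t^{\mathrm{des}(v^{-1})}$, $A^{\circ}_n(s,t)=\sum_{v\in\mathrm{Sym}[n]}s^{\mathrm{des}(v)}t^{\mathrm{asc}(v^{-1})}$, $B_n(s,t)=\sum_{(u,v)\in\mathrm{Bur}[n]}s^{n-\max(u)}t^{n-\max(v)}$, $B^{\circ}_n(s,t)=\sum_{(u,v)\in\mathrm{Bur}^{01}[n]}s^{n-\max(u)}t^{n-\max(v)}$. *)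

theory Defs
  imports
    "HOL-Library.FuncSet"
    "HOL-Combinatorics.Permutations"
    "HOL-Computational_Algebra.Polynomial"
begin

(* Maps [n] -> [n] are extensional functions: their value outside {1..n} is fixed to
   undefined, so that a map on [n] is represented by exactly one function nat => nat. *)
definition Cay :: "nat \<Rightarrow> (nat \<Rightarrow> nat) set" where
  "Cay n = {v \<in> {1..n} \<rightarrow>\<^sub>E {1..n}. \<exists>k\<le>n. v ` {1..n} = {1..k}}"

definition IncCay :: "nat \<Rightarrow> (nat \<Rightarrow> nat) set" where
  "IncCay n = {v \<in> Cay n. mono_on {1..n} v}"

(* Here the representative of a permutation of [n] is the one that is the identity outside {1..n};
   its inverse is then inv v. *)
definition Sym :: "nat \<Rightarrow> (nat \<Rightarrow> nat) set" where
  "Sym n = {v. v permutes {1..n}}"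

definition maxletter :: "nat \<Rightarrow> (nat \<Rightarrow> nat) \<Rightarrow> nat" where
  "maxletter n v = Max (v ` {1..n})"

definition weak_descents :: "nat \<Rightarrow> (nat \<Rightarrow> nat) \<Rightarrow> nat set" where
  "weak_descents n v = {i \<in> {1..n-1}. v i \<ge> v (i + 1)}"

definition strict_descents :: "nat \<Rightarrow> (nat \<Rightarrow> nat) \<Rightarrow> nat set" where
  "strict_descents n v = {i \<in> {1..n-1}. v i > v (i + 1)}"

definition des :: "nat \<Rightarrow> (nat \<Rightarrow> nat) \<Rightarrow> nat" where
  "des n v = card (weak_descents n v)"

definition asc :: "nat \<Rightarrow> (nat \<Rightarrow> nat) \<Rightarrow> nat" where
  "asc n v = card {i \<in> {1..n-1}. v i \<le> v (i + 1)}"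

definition Bur :: "nat \<Rightarrow> ((nat \<Rightarrow> nat) \<times> (nat \<Rightarrow> nat)) set" where
  "Bur n = {(u, v) \<in> IncCay n \<times> Cay n. weak_descents n u \<subseteq> weak_descents n v}"

definition Bur01 :: "nat \<Rightarrow> ((nat \<Rightarrow> nat) \<times> (nat \<Rightarrow> nat)) set" where
  "Bur01 n = {(u, v) \<in> IncCay n \<times> Cay n. weak_descents n u \<subseteq> strict_descents n v}"

(* The polynomial ring Z[s,t] is represented as Z[s][t]. *)
definition var_s :: "int poly poly" where
  "var_s = [:[:0, 1:]:]"

definition var_t :: "int poly poly" where
  "var_t = [:0, 1:]"

definition A_poly :: "nat \<Rightarrow> int poly poly" where
  "A_poly n = (\<Sum>v\<in>Sym n. var_s ^ des n v * var_t ^ des n (inv v))"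

definition A0_poly :: "nat \<Rightarrow> int poly poly" where
  "A0_poly n = (\<Sum>v\<in>Sym n. var_s ^ des n v * var_t ^ asc n (inv v))"

definition B_poly :: "nat \<Rightarrow> int poly poly" where
  "B_poly n = (\<Sum>(u, v)\<in>Bur n. var_s ^ (n - maxletter n u) * var_t ^ (n - maxletter n v))"

definition B0_poly :: "nat \<Rightarrow> int poly poly" where
  "B0_poly n = (\<Sum>(u, v)\<in>Bur01 n. var_s ^ (n - maxletter n u) * var_t ^ (n - maxletter n v))"

definition gamma_indices :: "nat \<Rightarrow> (nat \<times> nat) set" where
  "gamma_indices n = {(i, j). j + 2 * i \<le> n - 1}"

end

theory Submission
  imports Defs
begin

text \<open>
  The theorem reduces to the two identities \<open>B(s, t) = A(1 + s, 1 + t)\<close> and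
  \<open>B\<degree>(s, t) = A\<degree>(1 + s, 1 + t)\<close>, together with the reciprocity
  \<open>A\<degree>(s, t) = t^(n-1) A(s, 1/t)\<close>.  The substitution \<open>s := 1 + s\<close>, \<open>t := 1 + t\<close> turns
  \<open>st\<close>, \<open>s + t\<close> and \<open>1 + st\<close> into the three factors of the expansions of \<open>B\<close> and \<open>B\<degree>\<close>,
  while the reciprocity exchanges the roles of \<open>s + t\<close> and \<open>1 + st\<close>, that is, \<open>j\<close> and
  \<open>n - 1 - j - 2i\<close>.

  The factor \<open>1 + s\<close> arises because a weakly increasing Cayley permutation \<open>u\<close> is determined
  by its set of plateaus \<open>D(u)\<close>, which can be any subset of \<open>[n-1]\<close>, and has
  \<open>|D(u)| = n - max(u)\<close>; summing over all \<open>u\<close> with \<open>D(u) \<subseteq> X\<close> gives \<open>(1 + s)^|X|\<close>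
  (\<open>sum_IncCay\<close>).  The factor \<open>1 + t\<close> arises from standardization: every Cayley permutation is
  uniquely \<open>v = u \<circ> w\<close> with \<open>w\<close> a permutation and \<open>u\<close> a weakly increasing Cayley permutation
  that merges only letters whose positions in \<open>w\<close> respect a fixed tie-breaking rule
  (\<open>bij_betw_coarsenings_Cay\<close>).  If equal letters of \<open>v\<close> are numbered from right to left, the
  weak descents of \<open>v\<close> become the descents of \<open>w\<close>, and \<open>u\<close> ranges over
  \<open>D(u) \<subseteq> D(w\<inverse>)\<close>; numbering from left to right, the strict descents of \<open>v\<close> become the
  descents of \<open>w\<close>, and \<open>D(u)\<close> ranges over the subsets of the ascent set of \<open>w\<inverse>\<close>.  An arbitrary
  injective tie-breaker \<open>c\<close> treats the two cases at once (\<open>sum_Cay_eq_sum_Sym\<close>).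

  Polynomial identities are checked by evaluation at positive reals, where \<open>1/t\<close> makes sense.
  The comparison of the coefficients \<open>\<gamma>\<degree>\<close> and \<open>\<gamma>\<close> needs the linear independence of the
  products \<open>(st)^i (s + t)^j (1 + st)^(n-1-j-2i)\<close>, which is \<open>gamma_sum_eq_0\<close>.
\<close>

section \<open>Weakly increasing Cayley permutations\<close>

lemma weak_descents_subset: "weak_descents n v \<subseteq> {1..n-1}"
  by (auto simp: weak_descents_def)

text \<open>
  The weakly increasing Cayley permutation whose plateaus \<open>u i = u (i + 1)\<close> are exactly
  the \<open>i \<in> S\<close>: it starts at 1 and climbs by one at every index outside \<open>S\<close>.
\<close>

definition staircase :: "nat \<Rightarrow> nat set \<Rightarrow> nat \<Rightarrow> nat" where
  "staircase n S = (\<lambda>i\<in>{1..n}. Suc (card ({1..<i} - S)))"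

lemma card_diff_Suc:
  assumes "1 \<le> (i::nat)"
  shows "card ({1..<Suc i} - S) = card ({1..<i} - S) + (if i \<in> S then 0 else 1)"
proof -
  have "{1..<Suc i} - S = (if i \<in> S then {1..<i} - S else insert i ({1..<i} - S))"
    using assms by (auto simp: less_Suc_eq)
  then show ?thesis by simp
qed

lemma staircase_Suc:
  assumes "1 \<le> i" "i < n"
  shows "staircase n S (Suc i) = staircase n S i + (if i \<in> S then 0 else 1)"
  using assms card_diff_Suc[of i S] by (simp add: staircase_def)

lemma staircase_1: "n \<ge> 1 \<Longrightarrow> staircase n S 1 = 1"
  by (simp add: staircase_def)

lemma staircase_image:
  assumes "1 \<le> i" "i \<le> n"
  shows "staircase n S ` {1..i} = {1..staircase n S i}"
  using assms
proof (induction i rule: dec_induct)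
  case base
  then show ?case using staircase_1[of n S] by simp
next
  case (step i)
  have "{1..Suc i} = insert (Suc i) {1..i}" by auto
  then have "staircase n S ` {1..Suc i} = insert (staircase n S (Suc i)) {1..staircase n S i}"
    using step by simp
  moreover have "staircase n S i \<ge> 1" using step by (simp add: staircase_def)
  ultimately show ?case using staircase_Suc[of i n S] step by (auto simp: atLeastAtMostSuc_conv)
qed

lemma staircase_in_IncCay:
  assumes "n \<ge> 1"
  shows "staircase n S \<in> IncCay n"
proof -
  have le: "staircase n S i \<le> n" if "i \<in> {1..n}" for i
  proof -
    have "card ({1..<i} - S) \<le> card {1..<i}" by (intro card_mono) auto
    then have "card ({1..<i} - S) < i" using that by auto
    then show ?thesis using that by (simp add: staircase_def)
  qed
  have "staircase n S \<in> {1..n} \<rightarrow>\<^sub>E {1..n}"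
    using le by (simp add: staircase_def)
  moreover have "mono_on {1..n} (staircase n S)"
  proof (rule mono_onI)
    fix i j assume ij: "i \<in> {1..n}" "j \<in> {1..n}" "i \<le> j"
    then have "card ({1..<i} - S) \<le> card ({1..<j} - S)" by (intro card_mono) auto
    then show "staircase n S i \<le> staircase n S j" using ij by (simp add: staircase_def)
  qed
  moreover have "staircase n S ` {1..n} = {1..staircase n S n}" "staircase n S n \<le> n"
    using staircase_image[of n n S] le assms by auto
  ultimately show ?thesis unfolding IncCay_def Cay_def by auto
qed

lemma weak_descents_staircase:
  assumes "S \<subseteq> {1..n-1}"
  shows "weak_descents n (staircase n S) = S"
proof -
  have "staircase n S (i + 1) \<le> staircase n S i \<longleftrightarrow> i \<in> S" if "i \<in> {1..n-1}" for i
  proof -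
    have "i < n" using that by auto
    then show ?thesis using staircase_Suc[of i n S] that by simp
  qed
  then show ?thesis using assms unfolding weak_descents_def by auto
qed

text \<open>
  An increasing word with image \<open>{1..k}\<close> cannot skip a letter, so it starts at 1 and climbs by
  at most one; hence its plateaus determine it.
\<close>

lemma staircase_weak_descents:
  assumes "u \<in> IncCay n"
  shows "staircase n (weak_descents n u) = u"
proof -
  let ?D = "weak_descents n u"
  obtain k where k: "u ` {1..n} = {1..k}" and ext: "u \<in> {1..n} \<rightarrow>\<^sub>E {1..n}"
    and mono: "\<And>i j. 1 \<le> i \<Longrightarrow> i \<le> j \<Longrightarrow> j \<le> n \<Longrightarrow> u i \<le> u j"
    using assms unfolding IncCay_def Cay_def mono_on_def by auto
  have pre: "\<exists>j\<in>{1..n}. u j = m" if "1 \<le> m" "m \<le> u i" "i \<in> {1..n}" for m i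
  proof -
    have "u i \<in> {1..k}" using that k by blast
    then have "m \<in> u ` {1..n}" using that unfolding k by auto
    then show ?thesis by auto
  qed
  have pos: "u i \<ge> 1" if "i \<in> {1..n}" for i using that k by auto
  have "u i = staircase n ?D i" if "1 \<le> i" "i \<le> n" for i
    using that
  proof (induction i rule: dec_induct)
    case base
    obtain j where "j \<in> {1..n}" "u j = 1" using pre[of 1 1] pos[of 1] base by auto
    then have "u 1 \<le> 1" using mono[of 1 j] by auto
    then show ?case using staircase_1[of n ?D] pos[of 1] base by simp
  next
    case (step i)
    have le: "u i \<le> u (Suc i)" using mono[of i "Suc i"] step by simp
    have "u (Suc i) \<le> Suc (u i)"
    proof (rule ccontr)
      assume "\<not> u (Suc i) \<le> Suc (u i)"
      then obtain j where j: "j \<in> {1..n}" "u j = Suc (u i)"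
        using pre[of "Suc (u i)" "Suc i"] step by auto
      then show False using mono[of j i] mono[of "Suc i" j] step \<open>\<not> _\<close>
        by (cases "j \<le> i") auto
    qed
    then have "u (Suc i) = u i + (if i \<in> ?D then 0 else 1)"
      using le step by (auto simp: weak_descents_def)
    then show ?case using staircase_Suc[of i n ?D] step by simp
  qed
  then show ?thesis using ext by (auto simp: staircase_def PiE_iff extensional_def fun_eq_iff)
qed

lemma bij_betw_staircase:
  assumes "n \<ge> 1" "X \<subseteq> {1..n-1}"
  shows "bij_betw (staircase n) (Pow X) {u \<in> IncCay n. weak_descents n u \<subseteq> X}"
proof (rule bij_betw_byWitness[where f' = "weak_descents n"])
  show "\<forall>S\<in>Pow X. weak_descents n (staircase n S) = S"
    using weak_descents_staircase assms by (metis Pow_iff order_trans)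
qed (use assms staircase_weak_descents staircase_in_IncCay weak_descents_staircase[OF order_trans] in auto)

lemma maxletter_staircase:
  assumes "n \<ge> 1" "S \<subseteq> {1..n-1}"
  shows "n - maxletter n (staircase n S) = card S"
proof -
  have pos: "1 \<le> staircase n S n" using assms by (simp add: staircase_def)
  have "maxletter n (staircase n S) = staircase n S n"
    unfolding maxletter_def staircase_image[OF assms(1) order_refl]
    using pos by (intro Max_eqI) auto
  also have "\<dots> = Suc (card ({1..n-1} - S))"
  proof -
    have "{1..<n} = {1..n-1}" using assms by auto
    then show ?thesis using assms by (simp add: staircase_def)
  qed
  also have "card ({1..n-1} - S) = n - 1 - card S"
    using assms by (subst card_Diff_subset) (auto intro: finite_subset)
  finally show ?thesis using assms card_mono[of "{1..n-1}" S] by auto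
qed

lemma sum_power_card_Pow:
  fixes x :: "'a :: comm_semiring_1"
  assumes "finite X"
  shows "(\<Sum>S\<in>Pow X. x ^ card S) = (1 + x) ^ card X"
  using prod_add[OF assms, of "\<lambda>_. x" "\<lambda>_. 1"] by (simp add: add.commute)

text \<open>
  The sum runs over the staircases of the subsets of \<open>X\<close>, so it is the binomial theorem in
  disguise.
\<close>

lemma sum_IncCay:
  fixes x :: "'a :: comm_semiring_1"
  assumes "n \<ge> 1" "X \<subseteq> {1..n-1}"
  shows "(\<Sum>u | u \<in> IncCay n \<and> weak_descents n u \<subseteq> X. x ^ (n - maxletter n u)) = (1 + x) ^ card X"
proof -
  have "(\<Sum>u | u \<in> IncCay n \<and> weak_descents n u \<subseteq> X. x ^ (n - maxletter n u))
      = (\<Sum>S\<in>Pow X. x ^ (n - maxletter n (staircase n S)))"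
    by (rule sum.reindex_bij_betw[OF bij_betw_staircase[OF assms], symmetric])
  also have "\<dots> = (\<Sum>S\<in>Pow X. x ^ card S)"
    using assms maxletter_staircase by (intro sum.cong refl) (metis Pow_iff order_trans)
  also have "\<dots> = (1 + x) ^ card X"
    using assms finite_subset by (intro sum_power_card_Pow) auto
  finally show ?thesis .
qed

section \<open>Standardization of Cayley permutations\<close>

text \<open>
  The order in which standardization numbers the positions of the word \<open>v\<close>: by letter first,
  ties being broken by the value of \<open>c\<close> at the position.
\<close>

definition precedes :: "(nat \<Rightarrow> nat) \<Rightarrow> (nat \<Rightarrow> nat) \<Rightarrow> nat \<Rightarrow> nat \<Rightarrow> bool" where
  "precedes c v i j \<longleftrightarrow> v i < v j \<or> v i = v j \<and> c i < c j"

text \<open>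
  The adjacent letters \<open>a\<close>, \<open>a + 1\<close> of \<open>w\<close> may be identified without changing the
  standardization, because their positions \<open>inv w a\<close>, \<open>inv w (a + 1)\<close> are in the order that the
  tie-breaking rule would give to equal letters.
\<close>

definition mergeable :: "nat \<Rightarrow> (nat \<Rightarrow> nat) \<Rightarrow> (nat \<Rightarrow> nat) \<Rightarrow> nat set" where
  "mergeable n c w = {a \<in> {1..n-1}. c (inv w a) < c (inv w (a + 1))}"

definition coarsenings :: "nat \<Rightarrow> (nat \<Rightarrow> nat) \<Rightarrow> (nat \<Rightarrow> nat) \<Rightarrow> (nat \<Rightarrow> nat) set" where
  "coarsenings n c w = {u \<in> IncCay n. weak_descents n u \<subseteq> mergeable n c w}"

definition standardization :: "nat \<Rightarrow> (nat \<Rightarrow> nat) \<Rightarrow> (nat \<Rightarrow> nat) \<Rightarrow> nat \<Rightarrow> nat" where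
  "standardization n c v i =
    (if i \<in> {1..n} then Suc (card {j \<in> {1..n}. precedes c v j i}) else i)"

lemma Sym_in_range: "w \<in> Sym n \<Longrightarrow> i \<in> {1..n} \<Longrightarrow> w i \<in> {1..n}"
  unfolding Sym_def using permutes_in_image[of w "{1..n}" i] by auto

lemma inv_Sym: "w \<in> Sym n \<Longrightarrow> inv w \<in> Sym n"
  unfolding Sym_def using permutes_inv by auto

text \<open>
  Passing from \<open>a\<close> to \<open>a + 1\<close>, either \<open>u\<close> climbs or the letters are mergeable; the lexicographic
  alternative is transitive, so it extends from neighbours to all pairs.
\<close>

lemma coarsening_respects_order:
  assumes u: "u \<in> coarsenings n c w" and a: "1 \<le> a"
    and "Suc a \<le> b" "b \<le> n"
  shows "u a < u b \<or> u a = u b \<and> c (inv w a) < c (inv w b)"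
proof -
  have adj: "u b < u (Suc b) \<or> u b = u (Suc b) \<and> c (inv w b) < c (inv w (Suc b))"
    if "1 \<le> b" "Suc b \<le> n" for b
  proof -
    have "u b \<le> u (Suc b)"
      using u that unfolding coarsenings_def IncCay_def mono_on_def by auto
    moreover have "c (inv w b) < c (inv w (Suc b))" if "u b = u (Suc b)"
    proof -
      have "b \<in> weak_descents n u"
        using that \<open>1 \<le> b\<close> \<open>Suc b \<le> n\<close> by (auto simp: weak_descents_def)
      then show ?thesis using u by (auto simp: coarsenings_def mergeable_def)
    qed
    ultimately show ?thesis by auto
  qed
  show ?thesis using \<open>Suc a \<le> b\<close> \<open>b \<le> n\<close>
  proof (induction b rule: dec_induct)
    case base
    then show ?case using adj[OF a] by simp
  next
    case (step b)
    then show ?case using adj[of b] a by auto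
  qed
qed

text \<open>
  Both the uniqueness of \<open>w\<close> and the behaviour of descents under standardization follow from this.
\<close>

lemma precedes_coarsening:
  assumes w: "w \<in> Sym n" and u: "u \<in> coarsenings n c w" and "i \<in> {1..n}" "j \<in> {1..n}"
  shows "precedes c (restrict (u \<circ> w) {1..n}) i j \<longleftrightarrow> w i < w j"
proof -
  let ?v = "restrict (u \<circ> w) {1..n}"
  have p: "w permutes {1..n}" using w by (simp add: Sym_def)
  have *: "precedes c ?v i j" if "i \<in> {1..n}" "j \<in> {1..n}" "w i < w j" for i j
    using coarsening_respects_order[OF u, of "w i" "w j"] that
      Sym_in_range[OF w that(1)] Sym_in_range[OF w that(2)]
    by (simp add: precedes_def permutes_inverses(2)[OF p])
  show ?thesis
  proof
    assume "precedes c ?v i j"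
    moreover have "\<not> precedes c ?v i j" if "i = j \<or> precedes c ?v j i"
      using that by (auto simp: precedes_def)
    moreover have "i = j \<or> w i < w j \<or> w j < w i"
      using permutes_inj[OF p] by (metis injD linorder_neqE_nat)
    ultimately show "w i < w j" using * assms by blast
  qed (use * assms in auto)
qed

lemma standardization_coarsening:
  assumes w: "w \<in> Sym n" and u: "u \<in> coarsenings n c w"
  shows "standardization n c (restrict (u \<circ> w) {1..n}) = w"
proof
  fix i
  have p: "w permutes {1..n}" using w by (simp add: Sym_def)
  show "standardization n c (restrict (u \<circ> w) {1..n}) i = w i"
  proof (cases "i \<in> {1..n}")
    case True
    \<comment> \<open>Standardization counts the smaller positions, and a permutation is its own rank function.\<close>
    have "{j \<in> {1..n}. precedes c (restrict (u \<circ> w) {1..n}) j i} = {j \<in> {1..n}. w j < w i}"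
      using precedes_coarsening[OF w u _ True] by auto
    moreover have "card {j \<in> {1..n}. w j < w i} = card {1..<w i}"
    proof (rule bij_betw_same_card, rule bij_betw_imageI)
      show "inj_on w {j \<in> {1..n}. w j < w i}" using permutes_inj[OF p] by (auto simp: inj_on_def)
      show "w ` {j \<in> {1..n}. w j < w i} = {1..<w i}"
      proof (intro equalityI subsetI)
        fix b assume b: "b \<in> {1..<w i}"
        then have "b \<in> {1..n}" using Sym_in_range[OF w True] by auto
        then obtain j where "j \<in> {1..n}" "w j = b" using permutes_image[OF p] by (metis imageE)
        then show "b \<in> w ` {j \<in> {1..n}. w j < w i}" using b by auto
      qed (use Sym_in_range[OF w] in auto)
    qed
    ultimately show ?thesis using Sym_in_range[OF w True] True by (simp add: standardization_def)
  next
    case False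
    then show ?thesis using permutes_not_in[OF p False] by (auto simp: standardization_def)
  qed
qed

lemma standardization_less_iff:
  assumes c: "inj_on c {1..n}" and "i \<in> {1..n}" "j \<in> {1..n}"
  shows "standardization n c v i < standardization n c v j \<longleftrightarrow> precedes c v i j"
proof -
  have *: "standardization n c v i < standardization n c v j"
    if "i \<in> {1..n}" "j \<in> {1..n}" "precedes c v i j" for i j
  proof -
    have "{k \<in> {1..n}. precedes c v k i} \<subset> {k \<in> {1..n}. precedes c v k j}"
      using that by (auto simp: precedes_def)
    then show ?thesis using that by (simp add: standardization_def psubset_card_mono)
  qed
  have "i = j \<or> precedes c v i j \<or> precedes c v j i"
    using inj_onD[OF c, of i j] assms(2,3) unfolding precedes_def by (metis linorder_neqE_nat)
  then show ?thesis using *[of i j] *[of j i] assms(2,3) by auto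
qed

lemma standardization_in_Sym:
  assumes c: "inj_on c {1..n}"
  shows "standardization n c v \<in> Sym n"
proof -
  have "inj_on (standardization n c v) {1..n}"
  proof (rule inj_onI)
    fix i j assume "i \<in> {1..n}" "j \<in> {1..n}" "standardization n c v i = standardization n c v j"
    then show "i = j"
      using standardization_less_iff[OF c, of i j v] standardization_less_iff[OF c, of j i v]
        inj_onD[OF c, of i j] unfolding precedes_def by (metis linorder_neqE_nat less_irrefl)
  qed
  moreover have "standardization n c v ` {1..n} \<subseteq> {1..n}"
  proof -
    have "card {j \<in> {1..n}. precedes c v j i} < n" if "i \<in> {1..n}" for i
    proof -
      have "{j \<in> {1..n}. precedes c v j i} \<subseteq> {1..n} - {i}" by (auto simp: precedes_def)
      then have "card {j \<in> {1..n}. precedes c v j i} \<le> card ({1..n} - {i})"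
        by (intro card_mono) auto
      then show ?thesis using that by auto
    qed
    then show ?thesis by (auto simp: standardization_def Suc_le_eq simp del: One_nat_def)
  qed
  ultimately have "bij_betw (standardization n c v) {1..n} {1..n}"
    by (simp add: bij_betw_def endo_inj_surj)
  then have "standardization n c v permutes {1..n}"
    by (rule bij_imp_permutes) (auto simp: standardization_def)
  then show ?thesis by (simp add: Sym_def)
qed

lemma image_restrict_comp_Sym:
  assumes "w \<in> Sym n"
  shows "restrict (u \<circ> w) {1..n} ` {1..n} = u ` {1..n}"
proof -
  have "w ` {1..n} = {1..n}" using assms permutes_image by (auto simp: Sym_def)
  moreover have "restrict (u \<circ> w) {1..n} ` {1..n} = u ` w ` {1..n}" by auto
  ultimately show ?thesis by simp
qed

lemma restrict_comp_Sym_in_Cay: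
  assumes w: "w \<in> Sym n" and u: "u \<in> Cay n"
  shows "restrict (u \<circ> w) {1..n} \<in> Cay n"
proof -
  have "restrict (u \<circ> w) {1..n} \<in> {1..n} \<rightarrow>\<^sub>E {1..n}"
    using Sym_in_range[OF w] u by (auto simp: PiE_iff Cay_def)
  then show ?thesis using u unfolding Cay_def mem_Collect_eq image_restrict_comp_Sym[OF w] by blast
qed

text \<open>
  Listing the positions in numbering order makes \<open>v\<close> weakly increasing, and equal letters occur
  there in the order of their tie-breakers.
\<close>

lemma coarsening_of_standardization:
  assumes c: "inj_on c {1..n}" and v: "v \<in> Cay n"
  defines "w \<equiv> standardization n c v"
  shows "restrict (v \<circ> inv w) {1..n} \<in> coarsenings n c w"
proof -
  let ?u = "restrict (v \<circ> inv w) {1..n}"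
  have w: "w \<in> Sym n" unfolding w_def by (rule standardization_in_Sym[OF c])
  then have p: "w permutes {1..n}" by (simp add: Sym_def)
  have iv: "inv w a \<in> {1..n}" if "a \<in> {1..n}" for a using Sym_in_range[OF inv_Sym[OF w] that] .
  have pr: "precedes c v (inv w a) (inv w b)" if "a \<in> {1..n}" "b \<in> {1..n}" "a < b" for a b
    using standardization_less_iff[OF c iv[OF that(1)] iv[OF that(2)], of v] that
    by (simp add: w_def[symmetric] permutes_inverses(1)[OF p])
  have mono: "mono_on {1..n} ?u"
  proof (rule mono_onI)
    fix a b assume "a \<in> {1..n}" "b \<in> {1..n}" "a \<le> b"
    then show "?u a \<le> ?u b" using pr[of a b] by (cases "a = b") (auto simp: precedes_def)
  qed
  have "?u \<in> IncCay n"
    using restrict_comp_Sym_in_Cay[OF inv_Sym[OF w] v] mono by (simp add: IncCay_def)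
  moreover have "weak_descents n ?u \<subseteq> mergeable n c w"
  proof
    fix a assume a: "a \<in> weak_descents n ?u"
    then have "a \<in> {1..n}" "a + 1 \<in> {1..n}" by (auto simp: weak_descents_def)
    then show "a \<in> mergeable n c w" using pr[of a "a + 1"] a
      by (auto simp: weak_descents_def mergeable_def precedes_def)
  qed
  ultimately show ?thesis by (simp add: coarsenings_def)
qed

text \<open>
  A factorization \<open>v = u \<circ> w\<close> with \<open>u\<close> weakly increasing is in general not unique, since \<open>w\<close> may
  number equal letters in any order; the condition on \<open>u\<close> selects the order given by \<open>c\<close>, and so
  forces \<open>w\<close> to be the standardization of \<open>v\<close>.
\<close>

lemma bij_betw_coarsenings_Cay:
  assumes c: "inj_on c {1..n}"
  shows "bij_betw (\<lambda>(w, u). restrict (u \<circ> w) {1..n}) (Sigma (Sym n) (coarsenings n c)) (Cay n)"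
    (is "bij_betw ?F ?A _")
proof -
  let ?G = "\<lambda>v. (standardization n c v, restrict (v \<circ> inv (standardization n c v)) {1..n})"
  have cancel: "restrict (restrict (f \<circ> q) {1..n} \<circ> p) {1..n} = f"
    if "p \<in> Sym n" "\<And>i. q (p i) = i" "f \<in> {1..n} \<rightarrow>\<^sub>E {1..n}" for f p q
  proof
    fix i show "restrict (restrict (f \<circ> q) {1..n} \<circ> p) {1..n} i = f i"
      using Sym_in_range[OF that(1), of i] that(2,3)
      by (cases "i \<in> {1..n}") (auto simp: PiE_iff extensional_def)
  qed
  show ?thesis
  proof (rule bij_betw_byWitness[where f' = ?G])
    show "\<forall>z\<in>?A. ?G (?F z) = z"
    proof (rule ballI)
      fix z assume "z \<in> ?A"
      then obtain w u where z: "z = (w, u)" and w: "w \<in> Sym n" and u: "u \<in> coarsenings n c w"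
        by auto
      have p: "w permutes {1..n}" using w by (simp add: Sym_def)
      have "restrict (restrict (u \<circ> w) {1..n} \<circ> inv w) {1..n} = u"
        using u by (intro cancel inv_Sym[OF w] permutes_inverses(1)[OF p])
          (auto simp: coarsenings_def IncCay_def Cay_def)
      then show "?G (?F z) = z"
        unfolding z prod.case standardization_coarsening[OF w u] by simp
    qed
    show "\<forall>v\<in>Cay n. ?F (?G v) = v"
    proof (rule ballI)
      fix v assume v: "v \<in> Cay n"
      let ?w = "standardization n c v"
      have w: "?w \<in> Sym n" by (rule standardization_in_Sym[OF c])
      then have p: "?w permutes {1..n}" by (simp add: Sym_def)
      show "?F (?G v) = v"
        unfolding prod.case using v
        by (intro cancel w permutes_inverses(2)[OF p]) (auto simp: Cay_def)
    qed
    show "?F ` ?A \<subseteq> Cay n"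
      using restrict_comp_Sym_in_Cay by (auto simp: coarsenings_def IncCay_def simp del: One_nat_def)
    show "?G ` Cay n \<subseteq> ?A"
      using coarsening_of_standardization[OF c] standardization_in_Sym[OF c] by blast
  qed
qed

lemma finite_Cay: "finite (Cay n)"
  by (rule finite_subset[of _ "{1..n} \<rightarrow>\<^sub>E {1..n}"]) (auto simp: Cay_def intro!: finite_PiE)

lemma finite_IncCay: "finite (IncCay n)"
  using finite_Cay by (auto simp: IncCay_def)

lemma finite_Sym: "finite (Sym n)"
  by (simp add: Sym_def finite_permutations)

lemma weak_descents_Sym:
  assumes "w \<in> Sym n"
  shows "weak_descents n w = strict_descents n w"
proof -
  have "inj w" using assms permutes_inj by (auto simp: Sym_def)
  then have "w i \<noteq> w (i + 1)" for i by (metis injD Suc_eq_plus1 n_not_Suc_n)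
  then show ?thesis unfolding weak_descents_def strict_descents_def
    by (metis le_less)
qed

text \<open>
  Under \<open>v = u \<circ> w\<close> the descents of \<open>w\<close> are the \<open>i\<close> whose successor precedes them in the numbering
  order of \<open>v\<close>, and \<open>v\<close> has the same letters as \<open>u\<close>.  For fixed \<open>w\<close> the sum over \<open>u\<close> is
  therefore an instance of the binomial sum over plateau sets.
\<close>

lemma sum_Cay_eq_sum_Sym:
  fixes x y :: "'a :: comm_semiring_1"
  assumes n: "n \<ge> 1" and c: "inj_on c {1..n}"
  shows "(\<Sum>v\<in>Cay n. x ^ card {i \<in> {1..n-1}. precedes c v (i + 1) i} * y ^ (n - maxletter n v))
       = (\<Sum>w\<in>Sym n. x ^ des n w * (1 + y) ^ card (mergeable n c w))"
proof -
  let ?r = "\<lambda>u w. restrict (u \<circ> w) {1..n}"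
  let ?f = "\<lambda>v. x ^ card {i \<in> {1..n-1}. precedes c v (i + 1) i} * y ^ (n - maxletter n v)"
  have f: "?f (?r u w) = x ^ des n w * y ^ (n - maxletter n u)"
    if w: "w \<in> Sym n" and u: "u \<in> coarsenings n c w" for w u
  proof -
    have "{i \<in> {1..n-1}. precedes c (?r u w) (i + 1) i} = strict_descents n w"
      using precedes_coarsening[OF w u, of "_ + 1" ] unfolding strict_descents_def by auto
    moreover have "?r u w ` {1..n} = u ` {1..n}"
      by (rule image_restrict_comp_Sym[OF w])
    ultimately show ?thesis
      by (simp add: weak_descents_Sym[OF w] des_def maxletter_def del: One_nat_def)
  qed
  have fin: "finite (coarsenings n c w)" for w
    using finite_IncCay by (auto simp: coarsenings_def)
  have "(\<Sum>v\<in>Cay n. ?f v) = (\<Sum>(w, u)\<in>Sigma (Sym n) (coarsenings n c). ?f (?r u w))"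
    using sum.reindex_bij_betw[OF bij_betw_coarsenings_Cay[OF c], of ?f]
    by (simp add: case_prod_unfold)
  also have "\<dots> = (\<Sum>w\<in>Sym n. \<Sum>u\<in>coarsenings n c w. ?f (?r u w))"
    using finite_Sym fin by (intro sum.Sigma[symmetric]) auto
  also have "\<dots> = (\<Sum>w\<in>Sym n. \<Sum>u\<in>coarsenings n c w. x ^ des n w * y ^ (n - maxletter n u))"
    by (intro sum.cong refl f)
  also have "\<dots> = (\<Sum>w\<in>Sym n. x ^ des n w * (1 + y) ^ card (mergeable n c w))"
    unfolding sum_distrib_left[symmetric] coarsenings_def
    by (subst sum_IncCay[OF n]) (auto simp: mergeable_def)
  finally show ?thesis .
qed

section \<open>Generating functions of Burge words as Eulerian polynomials\<close>

text \<open>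
  Both kinds of Burge words are pairs with \<open>D(u)\<close> contained in a descent set \<open>D v\<close> of \<open>v\<close>; only the
  notion of descent differs.
\<close>

lemma sum_Bur_fibres:
  fixes x y :: "'a :: comm_semiring_1"
  assumes n: "n \<ge> 1" and D: "\<And>v. D v \<subseteq> {1..n-1}"
  shows "(\<Sum>(u, v) | u \<in> IncCay n \<and> v \<in> Cay n \<and> weak_descents n u \<subseteq> D v.
            x ^ (n - maxletter n u) * y ^ (n - maxletter n v))
       = (\<Sum>v\<in>Cay n. (1 + x) ^ card (D v) * y ^ (n - maxletter n v))"
proof -
  let ?U = "\<lambda>v. {u. u \<in> IncCay n \<and> weak_descents n u \<subseteq> D v}"
  have "(\<Sum>(u, v) | u \<in> IncCay n \<and> v \<in> Cay n \<and> weak_descents n u \<subseteq> D v.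
            x ^ (n - maxletter n u) * y ^ (n - maxletter n v))
      = (\<Sum>(v, u)\<in>Sigma (Cay n) ?U. x ^ (n - maxletter n u) * y ^ (n - maxletter n v))"
    by (rule sum.reindex_bij_witness[of _ prod.swap prod.swap]) auto
  also have "\<dots> = (\<Sum>v\<in>Cay n. \<Sum>u\<in>?U v. x ^ (n - maxletter n u) * y ^ (n - maxletter n v))"
    using finite_Cay finite_IncCay by (intro sum.Sigma[symmetric]) auto
  also have "\<dots> = (\<Sum>v\<in>Cay n. (1 + x) ^ card (D v) * y ^ (n - maxletter n v))"
    unfolding sum_distrib_right[symmetric] by (subst sum_IncCay[OF n D]) auto
  finally show ?thesis .
qed

text \<open>
  Ties are broken from right to left, so that a plateau of \<open>v\<close> counts as a descent.
\<close>

lemma sum_Bur: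
  fixes x y :: "'a :: comm_semiring_1"
  assumes n: "n \<ge> 1"
  shows "(\<Sum>(u, v)\<in>Bur n. x ^ (n - maxletter n u) * y ^ (n - maxletter n v))
       = (\<Sum>w\<in>Sym n. (1 + x) ^ des n w * (1 + y) ^ des n (inv w))"
proof -
  let ?c = "\<lambda>j. n - j"
  have Bur: "Bur n = {(u, v). u \<in> IncCay n \<and> v \<in> Cay n \<and> weak_descents n u \<subseteq> weak_descents n v}"
    by (auto simp: Bur_def)
  have D: "weak_descents n v = {i \<in> {1..n-1}. precedes ?c v (i + 1) i}" for v
    by (auto simp: weak_descents_def precedes_def)
  have M: "mergeable n ?c w = weak_descents n (inv w)" if "w \<in> Sym n" for w
  proof -
    have "n - inv w a < n - inv w (a + 1) \<longleftrightarrow> inv w (a + 1) < inv w a" if "a \<in> {1..n-1}" for a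
    proof -
      have "inv w (a + 1) \<le> n" "inv w a \<le> n"
        using Sym_in_range[OF inv_Sym[OF \<open>w \<in> Sym n\<close>], of "a + 1"]
          Sym_in_range[OF inv_Sym[OF \<open>w \<in> Sym n\<close>], of a] that by auto
      then show ?thesis by auto
    qed
    then show ?thesis
      unfolding weak_descents_Sym[OF inv_Sym[OF that]] mergeable_def strict_descents_def by auto
  qed
  have "inj_on ?c {1..n}" by (auto simp: inj_on_def)
  from sum_Cay_eq_sum_Sym[OF n this, of "1 + x" y]
  show ?thesis
    unfolding Bur sum_Bur_fibres[OF n, of "weak_descents n", OF weak_descents_subset] D[symmetric]
    by (simp add: M des_def)
qed

text \<open>
  Ties are broken from left to right, so that a plateau of \<open>v\<close> does not count as a descent.
\<close>

lemma sum_Bur01: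
  fixes x y :: "'a :: comm_semiring_1"
  assumes n: "n \<ge> 1"
  shows "(\<Sum>(u, v)\<in>Bur01 n. x ^ (n - maxletter n u) * y ^ (n - maxletter n v))
       = (\<Sum>w\<in>Sym n. (1 + x) ^ des n w * (1 + y) ^ asc n (inv w))"
proof -
  let ?c = "\<lambda>j::nat. j"
  have Bur: "Bur01 n = {(u, v). u \<in> IncCay n \<and> v \<in> Cay n \<and> weak_descents n u \<subseteq> strict_descents n v}"
    by (auto simp: Bur01_def)
  have D: "strict_descents n v = {i \<in> {1..n-1}. precedes ?c v (i + 1) i}" for v
    by (auto simp: strict_descents_def precedes_def)
  have sub: "strict_descents n v \<subseteq> {1..n-1}" for v by (auto simp: strict_descents_def)
  have M: "card (mergeable n ?c w) = asc n (inv w)" if "w \<in> Sym n" for w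
  proof -
    have "inj (inv w)" using inv_Sym[OF that] permutes_inj by (auto simp: Sym_def)
    then have "inv w i \<noteq> inv w (i + 1)" for i by (metis injD Suc_eq_plus1 n_not_Suc_n)
    then show ?thesis unfolding mergeable_def asc_def by (metis le_less)
  qed
  have "inj_on ?c {1..n}" by (auto simp: inj_on_def)
  from sum_Cay_eq_sum_Sym[OF n this, of "1 + x" y]
  show ?thesis
    unfolding Bur sum_Bur_fibres[OF n sub] D[symmetric] by (simp add: M)
qed
section \<open>Evaluation of integer polynomials in two variables\<close>

definition eval_coeff :: "real \<Rightarrow> int poly \<Rightarrow> real" where
  "eval_coeff x q = poly (map_poly of_int q) x"

definition eval2 :: "real \<Rightarrow> real \<Rightarrow> int poly poly \<Rightarrow> real" where
  "eval2 x y p = poly (map_poly (eval_coeff x) p) y"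

lemma map_poly_add_hom:
  assumes "f 0 = 0" "\<And>a b. f (a + b) = f a + f b"
  shows "map_poly f (p + q) = map_poly f p + map_poly f q"
  by (rule poly_eqI) (simp add: coeff_map_poly assms)

lemma map_poly_mult_hom:
  fixes f :: "'a :: comm_semiring_0 \<Rightarrow> 'b :: comm_semiring_0"
  assumes "f 0 = 0" "\<And>a b. f (a + b) = f a + f b" "\<And>a b. f (a * b) = f a * f b"
  shows "map_poly f (p * q) = map_poly f p * map_poly f q"
proof (rule poly_eqI)
  have sum: "f (sum g A) = (\<Sum>a\<in>A. f (g a))" for g :: "nat \<Rightarrow> 'a" and A
    by (induction A rule: infinite_finite_induct) (simp_all add: assms)
  show "coeff (map_poly f (p * q)) k = coeff (map_poly f p * map_poly f q) k" for k
    by (simp add: coeff_map_poly coeff_mult assms sum)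
qed

lemma eval_coeff_hom:
  "eval_coeff x 0 = 0" "eval_coeff x 1 = 1"
  "eval_coeff x (p + q) = eval_coeff x p + eval_coeff x q"
  "eval_coeff x (p * q) = eval_coeff x p * eval_coeff x q"
  by (simp_all add: eval_coeff_def map_poly_add_hom map_poly_mult_hom)

lemma eval2_hom [simp]:
  "eval2 x y 0 = 0" "eval2 x y 1 = 1"
  "eval2 x y (p + q) = eval2 x y p + eval2 x y q"
  "eval2 x y (p * q) = eval2 x y p * eval2 x y q"
  by (simp_all add: eval2_def map_poly_add_hom map_poly_mult_hom eval_coeff_hom)

lemma eval2_vars [simp]: "eval2 x y var_s = x" "eval2 x y var_t = y"
  by (simp_all add: eval2_def var_s_def var_t_def map_poly_pCons eval_coeff_def)

lemma eval2_power [simp]: "eval2 x y (p ^ k) = eval2 x y p ^ k"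
  by (induction k) simp_all

lemma eval2_sum [simp]: "eval2 x y (sum f A) = (\<Sum>a\<in>A. eval2 x y (f a))"
  by (induction A rule: infinite_finite_induct) simp_all

lemma eval2_uminus: "eval2 x y (- p) = - eval2 x y p"
  using eval2_hom(3)[of x y p "- p"] by simp

lemma eval2_of_nat: "eval2 x y (of_nat m) = of_nat m"
  by (induction m) simp_all

lemma eval2_of_int [simp]: "eval2 x y (of_int m) = of_int m"
  by (cases m) (simp_all add: eval2_uminus eval2_of_nat del: of_nat_Suc)

lemma eval2_numeral [simp]: "eval2 x y (numeral m) = numeral m"
  using eval2_of_int[of x y "numeral m"] by simp

lemma poly_eqI_positive:
  fixes p q :: "real poly"
  assumes "\<And>x. x > 0 \<Longrightarrow> poly p x = poly q x"
  shows "p = q"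
proof (rule ccontr)
  assume "p \<noteq> q"
  then have "finite {x. poly (p - q) x = 0}" by (intro poly_roots_finite) simp
  moreover have "{0<..} \<subseteq> {x. poly (p - q) x = 0}" using assms by auto
  ultimately have "finite {0::real<..}" by (rule rev_finite_subset)
  then show False using infinite_Ioi by blast
qed

text \<open>
  Positive points suffice to separate polynomials, and they avoid both \<open>t = 0\<close> in the reciprocity
  and zeros of \<open>1 + st\<close>.
\<close>

lemma eval2_eqI:
  assumes "\<And>x y. x > 0 \<Longrightarrow> y > 0 \<Longrightarrow> eval2 x y p = eval2 x y q"
  shows "p = q"
proof -
  have "eval_coeff x (coeff p k) = eval_coeff x (coeff q k)" if "x > 0" for x k
  proof -
    have "map_poly (eval_coeff x) p = map_poly (eval_coeff x) q"
      using assms that by (intro poly_eqI_positive) (auto simp: eval2_def)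
    then have "coeff (map_poly (eval_coeff x) p) k = coeff (map_poly (eval_coeff x) q) k" by simp
    then show ?thesis by (simp add: coeff_map_poly eval_coeff_hom)
  qed
  then have "map_poly of_int (coeff p k) = (map_poly of_int (coeff q k) :: real poly)" for k
    by (intro poly_eqI_positive) (auto simp: eval_coeff_def)
  then have "coeff (coeff p k) l = coeff (coeff q k) l" for k l
    by (metis (no_types, lifting) coeff_map_poly of_int_0 of_int_eq_iff)
  then show ?thesis by (intro poly_eqI)
qed

section \<open>Expansions of gamma type\<close>

definition gamma_sum :: "nat \<Rightarrow> (nat \<Rightarrow> nat \<Rightarrow> 'a) \<Rightarrow> 'a \<Rightarrow> 'a \<Rightarrow> 'a \<Rightarrow> 'a :: comm_ring_1" where
  "gamma_sum n g p q r = (\<Sum>(i, j)\<in>gamma_indices n. g i j * p ^ i * q ^ j * r ^ (n - 1 - j - 2 * i))"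

lemma eval2_gamma_sum:
  "eval2 x y (gamma_sum n g p q r)
     = gamma_sum n (\<lambda>i j. eval2 x y (g i j)) (eval2 x y p) (eval2 x y q) (eval2 x y r)"
  by (simp add: gamma_sum_def case_prod_unfold)

lemma gamma_sum_diff:
  "gamma_sum n g p q r - gamma_sum n h p q r = gamma_sum n (\<lambda>i j. g i j - h i j) p q r"
  by (simp add: gamma_sum_def sum_subtractf[symmetric] case_prod_unfold left_diff_distrib)

lemma gamma_sum_reflect:
  "gamma_sum n g p r q = gamma_sum n (\<lambda>i j. g i (n - 1 - j - 2 * i)) p q r"
proof -
  have inv: "n - 1 - (n - 1 - j - 2 * i) - 2 * i = j" if "j + 2 * i \<le> n - 1" for i j
    using that by linarith
  let ?\<rho> = "\<lambda>(i, j). (i, n - 1 - j - 2 * i)"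
  show ?thesis
    unfolding gamma_sum_def
  proof (rule sum.reindex_bij_witness[of _ ?\<rho> ?\<rho>], goal_cases)
    case (5 ij)
    then show ?case
      by (cases ij, simp only: gamma_indices_def mem_Collect_eq prod.case inv) (simp only: mult_ac)
  qed (auto simp: gamma_indices_def)
qed

text \<open>
  With \<open>n - 1 = 2i + j + (n - 1 - j - 2i)\<close>, the power \<open>y^(n-1)\<close> supplies \<open>y^2\<close> to each factor
  \<open>x/y\<close> and one \<open>y\<close> to each of the other factors.
\<close>

lemma gamma_sum_reciprocal:
  fixes x y :: "'a :: field"
  assumes "y \<noteq> 0"
  shows "y ^ (n - 1) * gamma_sum n g (x * inverse y) (x + inverse y) (1 + x * inverse y)
       = gamma_sum n g (x * y) (1 + x * y) (x + y)"
  unfolding gamma_sum_def sum_distrib_left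
proof (intro sum.cong refl, clarify)
  fix i j assume "(i, j) \<in> gamma_indices n"
  then have "n - 1 = 2 * i + j + (n - 1 - j - 2 * i)" by (simp add: gamma_indices_def)
  then have y: "y ^ (n - 1) = (y\<^sup>2) ^ i * y ^ j * y ^ (n - 1 - j - 2 * i)"
    by (metis power_add power_mult)
  have "x * y = y\<^sup>2 * (x * inverse y)" "1 + x * y = y * (x + inverse y)"
    "x + y = y * (1 + x * inverse y)"
    using assms by (simp_all add: field_simps power2_eq_square)
  then show "y ^ (n - 1) * (g i j * (x * inverse y) ^ i * (x + inverse y) ^ j
      * (1 + x * inverse y) ^ (n - 1 - j - 2 * i))
    = g i j * (x * y) ^ i * (1 + x * y) ^ j * (x + y) ^ (n - 1 - j - 2 * i)"
    unfolding y by (simp only: power_mult_distrib mult_ac)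
qed

lemma coeffs_0_if_infinite_roots:
  fixes f :: "nat \<Rightarrow> 'a :: {comm_ring_1, ring_no_zero_divisors}"
  assumes "infinite Z" "\<And>z. z \<in> Z \<Longrightarrow> (\<Sum>j\<le>m. f j * z ^ j) = 0" "j \<le> m"
  shows "f j = 0"
proof -
  define P where "P = (\<Sum>j\<le>m. monom (f j) j)"
  have "poly P z = 0" if "z \<in> Z" for z
    using assms(2)[OF that] by (simp add: P_def poly_sum poly_monom)
  then have "P = 0"
    using assms(1) poly_roots_finite[of P] finite_subset[of Z "{z. poly P z = 0}"] by auto
  then have "coeff P j = 0" by simp
  then show ?thesis using assms(3) by (simp add: P_def coeff_sum)
qed

lemma infinite_range_quot: "infinite ((\<lambda>k::nat. (1 + real k) / (2 + real k)\<^sup>2) ` UNIV)"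
proof (rule range_inj_infinite, rule injI)
  fix k l :: nat
  assume "(1 + real k) / (2 + real k)\<^sup>2 = (1 + real l) / (2 + real l)\<^sup>2"
  then have "(1 + real k) * (2 + real l)\<^sup>2 = (1 + real l) * (2 + real k)\<^sup>2"
    by (simp add: field_simps)
  then have "(real k - real l) * (real k * real l + real k + real l) = 0"
    by (simp add: algebra_simps power2_eq_square)
  then have "real k = real l \<or> real k * real l + real k + real l = 0" by simp
  moreover have "real k = 0 \<and> real l = 0" if "real k * real l + real k + real l = 0"
    using that by (metis add_nonneg_eq_0_iff mult_nonneg_nonneg of_nat_0_le_iff add_nonneg_nonneg)
  ultimately show "k = l" by auto
qed

text \<open>
  Linear independence of the products \<open>(xy)^i (x + y)^j (1 + xy)^(n-1-j-2i)\<close>.  Dividing by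
  \<open>(1 + xy)^(n-1)\<close> leaves monomials \<open>z^i w^j\<close> in \<open>z = xy / (1 + xy)^2\<close> and
  \<open>w = (x + y) / (1 + xy)\<close>.  For a fixed value of \<open>xy\<close>, infinitely many values of \<open>w\<close> occur, which
  isolates each \<open>j\<close>; then infinitely many values of \<open>z\<close> isolate each \<open>i\<close>.
\<close>

lemma gamma_sum_eq_0:
  fixes c :: "nat \<Rightarrow> nat \<Rightarrow> real"
  assumes zero: "\<And>x y. x > 0 \<Longrightarrow> y > 0 \<Longrightarrow> gamma_sum n c (x * y) (x + y) (1 + x * y) = 0"
    and "(i, j) \<in> gamma_indices n"
  shows "c i j = 0"
proof -
  \<comment> \<open>Extension by zero makes the index range a square, so that the two sums separate.\<close>
  define d where "d i j = (if j + 2 * i \<le> n - 1 then c i j else 0)" for i j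
  define z where "z y = y / (1 + y)\<^sup>2" for y :: real
  have inner: "(\<Sum>i\<le>n. d i j * z y ^ i) = 0" if y: "y > 0" and j: "j \<le> n" for y j
  proof -
    \<comment> \<open>In the rest of this step \<open>y\<close> is the fixed product; the two factors are \<open>k + 1\<close> and
      \<open>y / (k + 1)\<close>, whose sum is unbounded in \<open>k\<close>.\<close>
    define Z where "Z = (\<lambda>k::nat. (real (Suc k) + y / real (Suc k)) / (1 + y)) ` UNIV"
    have "infinite Z"
    proof
      assume "finite Z"
      then obtain B where B: "\<And>w. w \<in> Z \<Longrightarrow> w \<le> B" using bdd_above_finite unfolding bdd_above_def by metis
      obtain k :: nat where k: "B * (1 + y) < real k" using reals_Archimedean2 by blast
      have "(real (Suc k) + y / real (Suc k)) / (1 + y) \<le> B" unfolding Z_def by (intro B[unfolded Z_def] rangeI)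
      then have "real (Suc k) + y / real (Suc k) \<le> B * (1 + y)" using y by (simp add: pos_divide_le_eq)
      moreover have "y / real (Suc k) > 0" using y by simp
      ultimately show False using k by simp
    qed
    moreover have "(\<Sum>j\<le>n. (\<Sum>i\<le>n. d i j * z y ^ i) * w ^ j) = 0" if "w \<in> Z" for w
    proof -
      from that obtain k :: nat where w: "w = (real (Suc k) + y / real (Suc k)) / (1 + y)"
        by (auto simp: Z_def)
      let ?x = "real (Suc k)"
      have xy: "?x * (y / ?x) = y" by simp
      have q: "?x + y / ?x = w * (1 + y)" unfolding w using y by simp
      have "0 = gamma_sum n c y (w * (1 + y)) (1 + y)"
        using zero[of ?x "y / ?x"] y unfolding xy q by simp
      also have "\<dots> = (\<Sum>(i, j)\<in>gamma_indices n. (1 + y) ^ (n - 1) * (d i j * z y ^ i * w ^ j))"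
        unfolding gamma_sum_def
      proof (intro sum.cong refl, clarify)
        fix i j assume ij: "(i, j) \<in> gamma_indices n"
        then have "n - 1 = 2 * i + j + (n - 1 - j - 2 * i)" by (simp add: gamma_indices_def)
        then have p: "(1 + y) ^ (n - 1) = ((1 + y)\<^sup>2) ^ i * (1 + y) ^ j * (1 + y) ^ (n - 1 - j - 2 * i)"
          by (metis power_add power_mult)
        have "y = z y * (1 + y)\<^sup>2" using y by (simp add: z_def)
        then have yi: "y ^ i = z y ^ i * ((1 + y)\<^sup>2) ^ i" by (metis power_mult_distrib)
        show "c i j * y ^ i * (w * (1 + y)) ^ j * (1 + y) ^ (n - 1 - j - 2 * i)
            = (1 + y) ^ (n - 1) * (d i j * z y ^ i * w ^ j)"
          using ij unfolding p yi by (simp add: d_def gamma_indices_def power_mult_distrib)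
      qed
      also have "\<dots> = (1 + y) ^ (n - 1) * (\<Sum>(i, j)\<in>gamma_indices n. d i j * z y ^ i * w ^ j)"
        by (simp add: sum_distrib_left case_prod_unfold)
      also have "(\<Sum>(i, j)\<in>gamma_indices n. d i j * z y ^ i * w ^ j)
          = (\<Sum>(i, j)\<in>{..n} \<times> {..n}. d i j * z y ^ i * w ^ j)"
        by (rule sum.mono_neutral_left) (auto simp: gamma_indices_def d_def split: if_splits)
      also have "\<dots> = (\<Sum>j\<le>n. (\<Sum>i\<le>n. d i j * z y ^ i) * w ^ j)"
        unfolding sum_distrib_right sum.cartesian_product[symmetric] by (rule sum.swap)
      finally show ?thesis using y by simp
    qed
    ultimately show ?thesis using j by (rule coeffs_0_if_infinite_roots)
  qed
  have ij: "i \<le> n" "j \<le> n" using assms(2) by (auto simp: gamma_indices_def)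
  have "d i j = 0"
  proof (rule coeffs_0_if_infinite_roots[OF infinite_range_quot _ ij(1)])
    fix v assume "v \<in> range (\<lambda>k::nat. (1 + real k) / (2 + real k)\<^sup>2)"
    then obtain k :: nat where "v = z (1 + real k)" by (auto simp: z_def)
    then show "(\<Sum>i\<le>n. d i j * v ^ i) = 0" using inner[of "1 + real k" j] ij by simp
  qed
  then show ?thesis using assms(2) by (simp add: d_def gamma_indices_def)
qed

section \<open>Gamma expansions of Burge polynomials\<close>

lemma des_add_asc:
  assumes "w \<in> Sym n"
  shows "des n w + asc n w = n - 1"
proof -
  have "{1..n-1} = strict_descents n w \<union> {i \<in> {1..n-1}. w i \<le> w (i + 1)}"
    by (auto simp: strict_descents_def)
  then have "n - 1 = card (strict_descents n w \<union> {i \<in> {1..n-1}. w i \<le> w (i + 1)})"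
    by (metis card_atLeastAtMost diff_Suc_1' One_nat_def)
  also have "\<dots> = card (strict_descents n w) + card {i \<in> {1..n-1}. w i \<le> w (i + 1)}"
    by (rule card_Un_disjoint) (auto simp: strict_descents_def)
  finally show ?thesis by (simp add: des_def asc_def weak_descents_Sym[OF assms])
qed

lemma eval2_A_poly: "eval2 x y (A_poly n) = (\<Sum>w\<in>Sym n. x ^ des n w * y ^ des n (inv w))"
  by (simp add: A_poly_def)

lemma eval2_A0_poly: "eval2 x y (A0_poly n) = (\<Sum>w\<in>Sym n. x ^ des n w * y ^ asc n (inv w))"
  by (simp add: A0_poly_def)

lemma eval2_B_poly:
  assumes "n \<ge> 1"
  shows "eval2 x y (B_poly n) = eval2 (1 + x) (1 + y) (A_poly n)"
  unfolding eval2_A_poly sum_Bur[OF assms, symmetric] by (simp add: B_poly_def case_prod_unfold)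

lemma eval2_B0_poly:
  assumes "n \<ge> 1"
  shows "eval2 x y (B0_poly n) = eval2 (1 + x) (1 + y) (A0_poly n)"
  unfolding eval2_A0_poly sum_Bur01[OF assms, symmetric] by (simp add: B0_poly_def case_prod_unfold)

text \<open>
  A permutation has no plateaus, so ascents and descents of the inverse are complementary.
\<close>

lemma eval2_A0_poly_reciprocal:
  assumes "y \<noteq> 0"
  shows "eval2 x y (A0_poly n) = y ^ (n - 1) * eval2 x (inverse y) (A_poly n)"
proof -
  have "y ^ asc n (inv w) = y ^ (n - 1) * inverse y ^ des n (inv w)" if "w \<in> Sym n" for w
    using assms unfolding des_add_asc[OF inv_Sym[OF that], symmetric]
    by (simp add: power_add power_inverse)
  then show ?thesis
    unfolding eval2_A_poly eval2_A0_poly sum_distrib_left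
    by (intro sum.cong refl) (simp add: mult_ac)
qed

theorem mainTheorem7:
  fixes n :: nat and \<gamma> :: "nat \<Rightarrow> nat \<Rightarrow> int"
  assumes "n \<ge> 1"
    and "A_poly n = (\<Sum>(i, j)\<in>gamma_indices n. of_int (\<gamma> i j) * (var_s * var_t) ^ i
           * (var_s + var_t) ^ j * (1 + var_s * var_t) ^ (n - 1 - j - 2 * i))"
  shows "B_poly n = (\<Sum>(i, j)\<in>gamma_indices n. of_int (\<gamma> i j)
             * (var_s * var_t + var_s + var_t + 1) ^ i
             * (var_s + var_t + 2) ^ j
             * (var_s * var_t + var_s + var_t + 2) ^ (n - 1 - j - 2 * i))
    \<and> B0_poly n = (\<Sum>(i, j)\<in>gamma_indices n. of_int (\<gamma> i j)
             * (var_s * var_t + var_s + var_t + 1) ^ i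
             * (var_s + var_t + 2) ^ (n - 1 - j - 2 * i)
             * (var_s * var_t + var_s + var_t + 2) ^ j)
    \<and> (\<forall>\<gamma>0 :: nat \<Rightarrow> nat \<Rightarrow> int.
          A0_poly n = (\<Sum>(i, j)\<in>gamma_indices n. of_int (\<gamma>0 i j) * (var_s * var_t) ^ i
             * (var_s + var_t) ^ j * (1 + var_s * var_t) ^ (n - 1 - j - 2 * i))
          \<longrightarrow> (\<forall>(i, j)\<in>gamma_indices n. \<gamma>0 i j = \<gamma> i (n - 1 - j - 2 * i)))"
proof -
  let ?g = "\<lambda>i j. real_of_int (\<gamma> i j)"
  have "A_poly n = gamma_sum n (\<lambda>i j. of_int (\<gamma> i j)) (var_s * var_t) (var_s + var_t)
      (1 + var_s * var_t)"
    using assms(2) by (simp only: gamma_sum_def)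
  then have A: "eval2 x y (A_poly n) = gamma_sum n ?g (x * y) (x + y) (1 + x * y)" for x y
    by (simp add: eval2_gamma_sum)
  have A0: "eval2 x y (A0_poly n) = gamma_sum n ?g (x * y) (1 + x * y) (x + y)" if "y > 0" for x y
    using that gamma_sum_reciprocal[of y n ?g x] by (simp add: eval2_A0_poly_reciprocal A)
  have "B_poly n = gamma_sum n (\<lambda>i j. of_int (\<gamma> i j)) (var_s * var_t + var_s + var_t + 1)
      (var_s + var_t + 2) (var_s * var_t + var_s + var_t + 2)"
    by (rule eval2_eqI) (simp add: eval2_B_poly[OF assms(1)] A eval2_gamma_sum algebra_simps)
  moreover have "B0_poly n = gamma_sum n (\<lambda>i j. of_int (\<gamma> i j)) (var_s * var_t + var_s + var_t + 1)
      (var_s * var_t + var_s + var_t + 2) (var_s + var_t + 2)"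
    by (rule eval2_eqI) (simp add: eval2_B0_poly[OF assms(1)] A0 eval2_gamma_sum algebra_simps)
  moreover have "\<gamma>0 i j = \<gamma> i (n - 1 - j - 2 * i)"
    if "A0_poly n = (\<Sum>(i, j)\<in>gamma_indices n. of_int (\<gamma>0 i j) * (var_s * var_t) ^ i
             * (var_s + var_t) ^ j * (1 + var_s * var_t) ^ (n - 1 - j - 2 * i))"
      and ij: "(i, j) \<in> gamma_indices n" for \<gamma>0 :: "nat \<Rightarrow> nat \<Rightarrow> int" and i j
  proof -
    have "A0_poly n = gamma_sum n (\<lambda>i j. of_int (\<gamma>0 i j)) (var_s * var_t) (var_s + var_t)
        (1 + var_s * var_t)"
      using that(1) by (simp only: gamma_sum_def)
    then have A0': "eval2 x y (A0_poly n)
        = gamma_sum n (\<lambda>i j. real_of_int (\<gamma>0 i j)) (x * y) (x + y) (1 + x * y)" for x y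
      by (simp add: eval2_gamma_sum)
    have "gamma_sum n (\<lambda>i j. real_of_int (\<gamma>0 i j) - ?g i (n - 1 - j - 2 * i))
        (x * y) (x + y) (1 + x * y) = 0" if "y > 0" for x y
      using A0[OF that, of x] unfolding A0' gamma_sum_diff[symmetric]
        gamma_sum_reflect[of n ?g "x * y" "1 + x * y" "x + y"] by simp
    from gamma_sum_eq_0[OF this ij] show ?thesis by simp
  qed
  ultimately show ?thesis
    unfolding gamma_sum_def by (simp only: mult_ac) blast
qed

end
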